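(* Let $p:\mathbb{R}^n\to\mathbb{R}$ be a hyperbolic polynomial of degree $d$ along $e\in\mathbb{R}^n$, with hyperbolicity cone $\Lambda=\Lambda(p,e)$. Suppose that $p$ is complete, diagonalizable (with associated linear map $\Delta$) and that $\lambda(\mathbb{R}^n)=\mathbb{R}^d_{\downarrow}$ holds. For $x\in\mathbb{R}^n$, let $A\in\mathcal{G}_p$ be such that $x=A(\Delta(\lambda(x)))$ holds. Then $$P_\Lambda(x)=A(\Delta(\lambda(x)_+)),$$ where $\lambda(x)_+$ is the (Euclidean) projection of $\lambda(x)$ onto $\mathbb{R}^d_+$.
   Context: A homogeneous polynomial $p:\mathbb{R}^n\to\mathbb{R}$ of degree $d$ is hyperbolic along $e\in\mathbb{R}^n$ if $p(e)\neq 0$ and, for every $x\in\mathbb{R}^n$, the univariate polynomial $t\mapsto p(x-te)$ has only real roots. Its $d$ roots (with multiplicity), ordered decreasingly $\lambda_1(x)\ge\cdots\ge\lambda_d(x)$, are the eigenvalues of $x$, and $\lambda(x)=(\lambda_1(x),\dots,\lambda_d(x))\in\mathbb{R}^d_{\downarrow}$, where $\mathbb{R}^d_{\downarrow}=\{u\in\mathbb{R}^d\mid u_1\ge\cdots\ge u_d\}$. For $S\subseteq\mathbb{R}^n$, $\lambda(S)=\{\lambda(x)\mid x\in S\}$. The hyperbolicity cone is the closed convex cone $\Lambda(p,e)=\{x\in\mathbb{R}^n\mid\lambda_d(x)\ge 0\}$. $\mathbb{R}^d_+$ is the nonnegative orthant. $p$ is complete if $\{x\mid\lambda(x)=0\}=\{0\}$.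 For complete $p$, $\mathbb{R}^n$ is equipped with the norm $\|x\|_p=\|\lambda(x)\|_2$ (where $\|\cdot\|_2$ is the Euclidean norm on $\mathbb{R}^d$), which is induced by the inner product $\langle x,y\rangle_p=\frac14\|x+y\|_p^2-\frac14\|x-y\|_p^2$. The projection is $P_\Lambda(x)=\operatorname{argmin}_{y\in\Lambda}\|x-y\|_p$. $\mathcal{G}_p$ denotes the set of linear maps $A:\mathbb{R}^n\to\mathbb{R}^n$ with $A^*=A^{-1}$ (adjoint with respect to $\langle\cdot,\cdot\rangle_p$) and $\lambda(x)=\lambda(A(x))$ for all $x\in\mathbb{R}^n$; it is a group under composition. $p$ is diagonalizable if there exists a linear map $\Delta:\operatorname{span}\lambda(\mathbb{R}^n)\to\mathbb{R}^n$ such that (i) $\|u\|_2=\|\Delta(u)\|_p$ for all $u\in\operatorname{span}\lambda(\mathbb{R}^n)$, and (ii) for every $x\in\mathbb{R}^n$ there exists $A\in\mathcal{G}_p$ with $x=A(\Delta(\lambda(x)))$. Such a $\Delta$ is fixed. *)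

theory Defs
  imports "HOL-Analysis.Analysis"
    "HOL-Computational_Algebra.Computational_Algebra"
begin

text \<open>
  The space \<open>\<real>\<^sup>d\<close> of eigenvalue vectors is \<^typ>\<open>real^'d\<close> with \<open>'d\<close> a finite linearly ordered
  index type, so that \<open>d = CARD('d)\<close> and the order of \<open>'d\<close> plays the role of \<open>1 < \<dots> < d\<close>; in
  particular \<^term>\<open>Max (UNIV :: 'd::{finite,linorder} set)\<close> is the last index.  Notions that depend on
  the eigenvalue vector but whose own type does not mention \<open>'d\<close> take a \<open>TYPE('d)\<close> argument.
\<close>

text \<open>The sum ranges over the (finitely many) exponent vectors of total degree \<open>d\<close>.\<close>

definition homogeneous_polynomial :: "nat \<Rightarrow> (real^'n \<Rightarrow> real) \<Rightarrow> bool" where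
  "homogeneous_polynomial d p \<longleftrightarrow>
     (\<exists>c :: ('n \<Rightarrow> nat) \<Rightarrow> real. \<forall>x.
        p x = (\<Sum>\<alpha> | (\<Sum>i\<in>UNIV. \<alpha> i) = d. c \<alpha> * (\<Prod>i\<in>UNIV. (x $ i) ^ \<alpha> i)))"

text \<open>The univariate polynomial \<open>t \<mapsto> p (x - t e)\<close>; it exists and is unique for polynomial \<open>p\<close>.\<close>

definition line_poly :: "(real^'n \<Rightarrow> real) \<Rightarrow> real^'n \<Rightarrow> real^'n \<Rightarrow> real poly" where
  "line_poly p e x = (THE q. \<forall>t. poly q t = p (x - t *\<^sub>R e))"

definition hyperbolic :: "nat \<Rightarrow> (real^'n \<Rightarrow> real) \<Rightarrow> real^'n \<Rightarrow> bool" where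
  "hyperbolic d p e \<longleftrightarrow>
     homogeneous_polynomial d p \<and> p e \<noteq> 0 \<and>
     (\<forall>x. \<forall>z::complex. poly (map_poly complex_of_real (line_poly p e x)) z = 0 \<longrightarrow> z \<in> \<real>)"

definition decreasing_vectors :: "(real^('d::{finite,linorder})) set" where
  "decreasing_vectors = {u. \<forall>i j. i \<le> j \<longrightarrow> u $ j \<le> u $ i}"

text \<open>
  The decreasingly ordered vector of roots, with multiplicity, of \<^term>\<open>line_poly p e x\<close>.
  It is meaningful when \<open>p\<close> is hyperbolic along \<open>e\<close> of degree \<open>CARD('d)\<close>.
\<close>

definition eigenvalues ::
  "(real^'n \<Rightarrow> real) \<Rightarrow> real^'n \<Rightarrow> real^'n \<Rightarrow> real^('d::{finite,linorder})" where
  "eigenvalues p e x =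
     (THE u. u \<in> decreasing_vectors \<and>
             image_mset (\<lambda>i. u $ i) (mset_set UNIV) = proots (line_poly p e x))"

definition hyperbolicity_cone ::
  "('d::{finite,linorder}) itself \<Rightarrow> (real^'n \<Rightarrow> real) \<Rightarrow> real^'n \<Rightarrow> (real^'n) set" where
  "hyperbolicity_cone TYPE('d) p e =
     {x. 0 \<le> (eigenvalues p e x :: real^('d::{finite,linorder})) $ Max UNIV}"

definition complete_hyperbolic ::
  "('d::{finite,linorder}) itself \<Rightarrow> (real^'n \<Rightarrow> real) \<Rightarrow> real^'n \<Rightarrow> bool" where
  "complete_hyperbolic TYPE('d) p e \<longleftrightarrow>
     {x. (eigenvalues p e x :: real^('d::{finite,linorder})) = 0} = {0}"

definition hyp_norm ::
  "('d::{finite,linorder}) itself \<Rightarrow> (real^'n \<Rightarrow> real) \<Rightarrow> real^'n \<Rightarrow> real^'n \<Rightarrow> real" where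
  "hyp_norm TYPE('d) p e x = norm (eigenvalues p e x :: real^('d::{finite,linorder}))"

definition hyp_inner ::
  "('d::{finite,linorder}) itself \<Rightarrow> (real^'n \<Rightarrow> real) \<Rightarrow> real^'n \<Rightarrow> real^'n \<Rightarrow> real^'n \<Rightarrow> real" where
  "hyp_inner D p e x y = 1/4 * (hyp_norm D p e (x + y))\<^sup>2 - 1/4 * (hyp_norm D p e (x - y))\<^sup>2"

definition hyp_projection ::
  "('d::{finite,linorder}) itself \<Rightarrow> (real^'n \<Rightarrow> real) \<Rightarrow> real^'n \<Rightarrow> real^'n \<Rightarrow> real^'n" where
  "hyp_projection D p e x = arg_min_on (\<lambda>y. hyp_norm D p e (x - y)) (hyperbolicity_cone D p e)"

text \<open>The third conjunct says that \<^term>\<open>inv A\<close> is the adjoint of \<open>A\<close> for \<^const>\<open>hyp_inner\<close>.\<close>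

definition eigenvalue_isometries ::
  "('d::{finite,linorder}) itself \<Rightarrow> (real^'n \<Rightarrow> real) \<Rightarrow> real^'n \<Rightarrow> (real^'n \<Rightarrow> real^'n) set" where
  "eigenvalue_isometries TYPE('d) p e =
     {A. linear A \<and> bij A \<and>
         (\<forall>x y. hyp_inner TYPE('d) p e (A x) y = hyp_inner TYPE('d) p e x (inv A y)) \<and>
         (\<forall>x. (eigenvalues p e x :: real^('d::{finite,linorder})) = eigenvalues p e (A x))}"

text \<open>
  \<open>p\<close> is diagonalizable with associated map \<open>\<Delta>\<close>.  Only the values of \<open>\<Delta>\<close> on the span of
  the range of the eigenvalue map are constrained.
\<close>

definition diagonalizable_by ::
  "(real^'n \<Rightarrow> real) \<Rightarrow> real^'n \<Rightarrow> (real^('d::{finite,linorder}) \<Rightarrow> real^'n) \<Rightarrow> bool" where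
  "diagonalizable_by p e \<Delta> \<longleftrightarrow>
     (let S = span (range (eigenvalues p e :: real^'n \<Rightarrow> real^('d::{finite,linorder}))) in
        (\<forall>u\<in>S. \<forall>v\<in>S. \<Delta> (u + v) = \<Delta> u + \<Delta> v) \<and>
        (\<forall>c. \<forall>u\<in>S. \<Delta> (c *\<^sub>R u) = c *\<^sub>R \<Delta> u) \<and>
        (\<forall>u\<in>S. norm u = hyp_norm TYPE('d) p e (\<Delta> u))) \<and>
     (\<forall>x. \<exists>A\<in>eigenvalue_isometries TYPE('d) p e. x = A (\<Delta> (eigenvalues p e x)))"

definition nonneg_orthant :: "(real^'d) set" where
  "nonneg_orthant = {u. \<forall>i. 0 \<le> u $ i}"

end

theory Submission
  imports Defs
begin

text \<open>
  Since \<open>p (e + r x) = p e \<Prod>\<^sub>i (1 + r \<lambda>\<^sub>i(x))\<close>, the elementary symmetric functions of the eigenvalues are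
  polynomial and homogeneous in \<open>x\<close>.  In particular \<open>\<parallel>x\<parallel>\<^sup>2 = E\<^sub>1(x)\<^sup>2 - 2 E\<^sub>2(x)\<close> is a quadratic form, so
  \<open>\<langle>\<cdot>,\<cdot>\<rangle>\<close> is bilinear.  Put \<open>y = A (\<Delta> \<lambda>(x)\<^sub>+)\<close> and \<open>w = y - x = A (\<Delta> \<lambda>(x)\<^sub>-)\<close>.  Then \<open>\<langle>y,w\<rangle> = 0\<close>, and if
  \<open>\<langle>z,w\<rangle> \<ge> 0\<close> for all \<open>z\<close> in the cone, then \<open>\<parallel>x - z\<parallel>\<^sup>2 \<ge> \<parallel>x - y\<parallel>\<^sup>2 + \<parallel>y - z\<parallel>\<^sup>2\<close>, so \<open>y\<close> is the unique
  nearest point.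

  Diagonalizability writes \<open>z\<close> and \<open>w\<close> as nonnegative combinations of rank-one elements, i.e. elements
  with eigenvalues \<open>1, 0, \<dots>, 0\<close>, so it remains to see \<open>\<langle>c,c'\<rangle> \<ge> 0\<close> for \<open>c\<close>, \<open>c'\<close> of rank one.  All
  eigenvalues of \<open>c + s c'\<close> but one are \<open>O(s)\<close>, hence \<open>E\<^sub>k(c + s c') = O(s\<^bsup>k-1\<^esup>)\<close>; the same holds with
  \<open>c\<close> and \<open>c'\<close> exchanged, and homogeneity forces \<open>E\<^sub>k(c + c') = 0\<close> for \<open>k \<ge> 3\<close>.  So
  \<open>1 + 2 r + E\<^sub>2(c + c') r\<^sup>2\<close> is real-rooted, which gives \<open>\<langle>c,c'\<rangle> = 1 - E\<^sub>2(c + c') \<ge> 0\<close>.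
\<close>

no_notation fps_nth (infixl "$" 75)

subsection \<open>Univariate polynomials\<close>

lemma poly_eqI_infinite:
  fixes f g :: "'a::idom poly"
  assumes "infinite S" and "\<And>s. s \<in> S \<Longrightarrow> poly f s = poly g s"
  shows "f = g"
proof (rule ccontr)
  assume "f \<noteq> g"
  then have "finite {s. poly (f - g) s = 0}"
    by (intro poly_roots_finite) simp
  moreover have "S \<subseteq> {s. poly (f - g) s = 0}"
    using assms(2) by auto
  ultimately show False
    using assms(1) finite_subset by blast
qed

lemma poly_inversion:
  fixes f g :: "real poly"
  assumes inv: "\<And>s. s \<noteq> 0 \<Longrightarrow> poly f s = s ^ k * poly g (1 / s)"
  shows "degree f \<le> k" and "\<lbrakk>degree g \<le> k; j \<le> k\<rbrakk> \<Longrightarrow> coeff f j = coeff g (k - j)"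
proof -
  let ?m = "degree g"
  have infin: "infinite (UNIV - {0::real})"
    using infinite_UNIV_char_0 by (rule Diff_infinite_finite[rotated]) simp
  \<comment> \<open>At nonzero s both sides equal s^(degree g + k) g(1/s); multiplying through
    avoids comparing the degree of g with k in advance.\<close>
  have eq: "monom 1 ?m * f = monom 1 k * reflect_poly g"
  proof (rule poly_eqI_infinite[OF infin])
    fix s :: real
    assume "s \<in> UNIV - {0}"
    then have s: "s \<noteq> 0" by simp
    show "poly (monom 1 ?m * f) s = poly (monom 1 k * reflect_poly g) s"
      using s by (simp add: poly_monom inv poly_reflect_poly_nz inverse_eq_divide)
  qed
  show "coeff f j = coeff g (k - j)" if "degree g \<le> k" "j \<le> k"
    using arg_cong[OF eq, of "\<lambda>h. coeff h (?m + j)"] that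
    by (auto simp: coeff_monom_mult coeff_reflect_poly coeff_eq_0 split: if_splits)
  show "degree f \<le> k"
  proof (cases "f = 0")
    case False
    then have "?m + degree f = degree (monom 1 ?m * f)"
      by (simp add: degree_mult_eq degree_monom_eq)
    also have "\<dots> \<le> k + degree (reflect_poly g)"
      unfolding eq by (rule order_trans[OF degree_mult_le]) (simp add: degree_monom_eq)
    also have "\<dots> \<le> k + ?m"
      by (simp add: degree_reflect_poly_le)
    finally show ?thesis by simp
  qed simp
qed

text \<open>For nonzero s, F (y + s z) = s^k F (z + y/s), so exchanging base point and direction
  reverses the coefficients. Applied to \<open>p\<close>, to the squared norm and to the symmetric
  functions of the eigenvalues.\<close>

lemma homogeneous_along_line:
  fixes F :: "'v::real_vector \<Rightarrow> real"
  assumes scale: "\<And>s x. F (s *\<^sub>R x) = s ^ k * F x"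
    and f: "\<And>s. poly f s = F (y + s *\<^sub>R z)" and g: "\<And>s. poly g s = F (z + s *\<^sub>R y)"
  shows "degree f \<le> k" and "j \<le> k \<Longrightarrow> coeff f j = coeff g (k - j)"
    and "coeff f 0 = F y" and "coeff f k = F z"
proof -
  have swap: "F (a + s *\<^sub>R b) = s ^ k * F (b + (1 / s) *\<^sub>R a)" if "s \<noteq> 0" for s a b
    unfolding scale[symmetric] using that by (simp add: algebra_simps)
  have "poly f s = s ^ k * poly g (1 / s)" "poly g s = s ^ k * poly f (1 / s)" if "s \<noteq> 0" for s
    unfolding f g using swap that by blast+
  note inv = poly_inversion[OF this(1)] poly_inversion(1)[OF this(2)]
  show "degree f \<le> k" and flip: "j \<le> k \<Longrightarrow> coeff f j = coeff g (k - j)" for j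
    using inv by blast+
  show "coeff f 0 = F y"
    using f[of 0] by (simp add: poly_0_coeff_0)
  show "coeff f k = F z"
    using flip[of k] g[of 0] by (simp add: poly_0_coeff_0)
qed

lemma map_poly_of_real_mult:
  "map_poly complex_of_real (f * g) = map_poly of_real f * map_poly of_real g"
  by (rule poly_eqI) (simp add: coeff_map_poly coeff_mult)

lemma poly_map_poly_of_real:
  "poly (map_poly complex_of_real f) (of_real a) = of_real (poly f a)"
  by (simp add: poly_altdef degree_map_poly coeff_map_poly)

text \<open>A nonconstant f has a complex root, real by assumption, and the cofactor inherits
  real-rootedness.\<close>

lemma real_rooted_splits:
  fixes f :: "real poly"
  assumes "f \<noteq> 0" and "\<And>z. poly (map_poly complex_of_real f) z = 0 \<Longrightarrow> z \<in> \<real>"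
  obtains M where "f = smult (lead_coeff f) (\<Prod>a\<in>#M. [:- a, 1:])"
proof -
  have "\<exists>M. f = smult (lead_coeff f) (\<Prod>a\<in>#M. [:- a, 1:])"
    using assms
  proof (induction "degree f" arbitrary: f)
    case 0
    then obtain c where "f = [:c:]"
      by (metis degree_eq_zeroE)
    then show ?case by (intro exI[of _ "{#}"]) simp
  next
    case (Suc n)
    have "degree (map_poly complex_of_real f) = Suc n"
      using Suc.hyps(2) by (simp add: degree_map_poly)
    then have "\<not> constant (poly (map_poly complex_of_real f))"
      by (simp add: constant_degree)
    then obtain z where z: "poly (map_poly complex_of_real f) z = 0"
      using fundamental_theorem_of_algebra by blast
    with Suc.prems obtain a where a: "z = complex_of_real a"
      by (metis Reals_cases)
    then have "poly f a = 0"
      using z by (simp add: poly_map_poly_of_real)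
    then obtain g where g: "f = [:- a, 1:] * g"
      by (metis dvdE poly_eq_0_iff_dvd)
    with Suc.prems have g0: "g \<noteq> 0" by auto
    have "degree f = Suc (degree g)"
      unfolding g using g0 by (subst degree_mult_eq) auto
    moreover have "w \<in> \<real>" if "poly (map_poly complex_of_real g) w = 0" for w
      by (rule Suc.prems(2)) (simp add: g map_poly_of_real_mult that del: mult_pCons_left)
    ultimately have "\<exists>M. g = smult (lead_coeff g) (\<Prod>a\<in>#M. [:- a, 1:])"
      using Suc.hyps g0 by auto
    then obtain M where M: "g = smult (lead_coeff g) (\<Prod>a\<in>#M. [:- a, 1:])"
      by blast
    have "lead_coeff f = lead_coeff g"
      unfolding g lead_coeff_mult by simp
    then have "f = [:- a, 1:] * smult (lead_coeff f) (\<Prod>a\<in>#M. [:- a, 1:])"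
      using M g by metis
    also have "\<dots> = smult (lead_coeff f) (\<Prod>a\<in>#add_mset a M. [:- a, 1:])"
      by (simp only: mult_smult_right image_mset_add_mset prod_mset.add_mset)
    finally have "f = smult (lead_coeff f) (\<Prod>a\<in>#add_mset a M. [:- a, 1:])" .
    then show ?case by blast
  qed
  then show ?thesis using that by blast
qed

text \<open>Letting s tend to 0 gives f(0) = 0, and dividing by s lowers m by one. The bound is
  asked only at nonzero s, so the quotient inherits it.\<close>

lemma poly_small_coeff_0:
  fixes f :: "real poly"
  assumes "0 < \<delta>" and "\<And>s. 0 < \<bar>s\<bar> \<Longrightarrow> \<bar>s\<bar> < \<delta> \<Longrightarrow> \<bar>poly f s\<bar> \<le> K * \<bar>s\<bar> ^ m" and "j < m"
  shows "coeff f j = 0"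
  using assms(2,3)
proof (induction m arbitrary: f j)
  case (Suc m)
  obtain a g where f: "f = pCons a g" by (cases f)
  have near: "\<forall>\<^sub>F s in at 0. 0 < \<bar>s\<bar> \<and> \<bar>s\<bar> < \<delta>"
    using assms(1) by (auto simp: eventually_at dist_real_def intro!: exI[of _ \<delta>])
  have "(poly f \<longlongrightarrow> poly f 0) (at 0)"
    by (intro tendsto_intros)
  moreover have "(poly f \<longlongrightarrow> 0) (at 0)"
  proof (rule Lim_null_comparison)
    show "\<forall>\<^sub>F s in at 0. norm (poly f s) \<le> K * \<bar>s\<bar> ^ Suc m"
      using near by eventually_elim (simp only: real_norm_def Suc.prems(1))
    have "((\<lambda>s. K * \<bar>s\<bar> ^ Suc m) \<longlongrightarrow> K * \<bar>0\<bar> ^ Suc m) (at (0::real))"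
      by (intro tendsto_intros)
    then show "((\<lambda>s. K * \<bar>s\<bar> ^ Suc m) \<longlongrightarrow> 0) (at (0::real))"
      by simp
  qed
  ultimately have "poly f 0 = 0"
    using LIM_unique by blast
  then have a: "a = 0" unfolding f by simp
  have "\<bar>poly g s\<bar> \<le> K * \<bar>s\<bar> ^ m" if "0 < \<bar>s\<bar>" "\<bar>s\<bar> < \<delta>" for s
    using Suc.prems(1)[OF that] that unfolding f a by (simp add: abs_mult algebra_simps)
  then have "coeff g i = 0" if "i < m" for i
    using Suc.IH that by blast
  then show ?case
    using Suc.prems(2) unfolding f a by (cases j) auto
qed simp

text \<open>A zero of a nonnegative polynomial is a minimum, hence a double root; the cofactor of
  s^2 is bounded on [-1, 1].\<close>

lemma poly_nonneg_double_root:
  fixes f :: "real poly"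
  assumes "\<And>s. 0 \<le> poly f s" and "poly f 0 = 0"
  obtains C where "0 < C" and "\<And>s. \<bar>s\<bar> \<le> 1 \<Longrightarrow> poly f s \<le> (C * s)\<^sup>2"
proof -
  obtain a g where f: "f = pCons a g" by (cases f)
  have "poly (pderiv f) 0 = 0"
    by (rule DERIV_local_min[OF poly_DERIV, of 1]) (use assms in auto)
  with assms(2) have "a = 0" "poly g 0 = 0"
    unfolding f by (auto simp: pderiv_pCons)
  then obtain h where h: "f = pCons 0 (pCons 0 h)"
    unfolding f by (metis pCons_cases poly_pCons add.right_neutral mult_zero_left)
  have "compact (poly h ` {-1..1})"
    by (intro compact_continuous_image continuous_intros) simp
  then obtain B where "0 < B" and B': "\<forall>y\<in>poly h ` {-1..1}. norm y \<le> B"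
    using compact_imp_bounded bounded_pos by metis
  then have B: "\<bar>poly h s\<bar> \<le> B" if "\<bar>s\<bar> \<le> 1" for s
    using that by (auto simp: abs_le_iff)
  have "poly f s \<le> (sqrt B * s)\<^sup>2" if "\<bar>s\<bar> \<le> 1" for s
  proof -
    have "poly f s = poly h s * s\<^sup>2"
      unfolding h by (simp add: power2_eq_square)
    also have "\<dots> \<le> B * s\<^sup>2"
      using B[OF that] by (intro mult_right_mono) auto
    finally show ?thesis
      using \<open>0 < B\<close> by (simp add: power_mult_distrib)
  qed
  then show ?thesis
    using that[of "sqrt B"] \<open>0 < B\<close> by simp
qed

section \<open>Elementary symmetric functions as coefficients: Newton's identities and
  bounds\<close>

lemma coeff_prod_linear_0: "finite I \<Longrightarrow> coeff (\<Prod>i\<in>I. [:1, f i:]) 0 = (1::real)"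
  by (induction I rule: finite_induct) (auto simp: coeff_mult)

lemma coeff_linear_mult_Suc: "coeff ([:1, a:] * h) (Suc k) = coeff h (Suc k) + a * coeff h k"
  for a :: real
  by simp

text \<open>A new factor with entry a adds a times the old \<open>c (k - 1)\<close> to
  \<open>c k\<close>. Degree four is reached because the sum of the squares of a (1 - a) will be
  expanded.\<close>

lemma newton_power_sums:
  fixes f :: "'i \<Rightarrow> real"
  assumes "finite I"
  defines "c \<equiv> coeff (\<Prod>i\<in>I. [:1, f i:])"
  shows "(\<Sum>i\<in>I. f i) = c 1"
    and "(\<Sum>i\<in>I. (f i)\<^sup>2) = (c 1)\<^sup>2 - 2 * c 2"
    and "(\<Sum>i\<in>I. f i ^ 3) = c 1 ^ 3 - 3 * c 1 * c 2 + 3 * c 3"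
    and "(\<Sum>i\<in>I. f i ^ 4) = c 1 ^ 4 - 4 * (c 1)\<^sup>2 * c 2 + 2 * (c 2)\<^sup>2 + 4 * c 1 * c 3 - 4 * c 4"
proof -
  have "(\<Sum>i\<in>I. f i) = c 1 \<and> (\<Sum>i\<in>I. (f i)\<^sup>2) = (c 1)\<^sup>2 - 2 * c 2
    \<and> (\<Sum>i\<in>I. f i ^ 3) = c 1 ^ 3 - 3 * c 1 * c 2 + 3 * c 3
    \<and> (\<Sum>i\<in>I. f i ^ 4) = c 1 ^ 4 - 4 * (c 1)\<^sup>2 * c 2 + 2 * (c 2)\<^sup>2 + 4 * c 1 * c 3 - 4 * c 4"
    using assms(1) unfolding c_def
  proof (induction I rule: finite_induct)
    case (insert a I)
    define h where "h = (\<Prod>i\<in>I. [:1, f i:])"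
    have h0: "coeff h 0 = 1"
      unfolding h_def using insert.hyps(1) by (rule coeff_prod_linear_0)
    have P: "(\<Prod>i\<in>insert a I. [:1, f i:]) = [:1, f a:] * h"
      unfolding h_def using insert.hyps by simp
    have c: "coeff ([:1, f a:] * h) 1 = coeff h 1 + f a"
      "coeff ([:1, f a:] * h) 2 = coeff h 2 + f a * coeff h 1"
      "coeff ([:1, f a:] * h) 3 = coeff h 3 + f a * coeff h 2"
      "coeff ([:1, f a:] * h) 4 = coeff h 4 + f a * coeff h 3"
      using coeff_linear_mult_Suc[of "f a" h 0] coeff_linear_mult_Suc[of "f a" h 1]
        coeff_linear_mult_Suc[of "f a" h 2] coeff_linear_mult_Suc[of "f a" h 3] h0
      by (simp_all add: eval_nat_numeral del: mult_pCons_left)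
    show ?case
      unfolding P c sum.insert[OF insert.hyps] using insert.IH unfolding h_def[symmetric]
      by (simp add: power2_eq_square power3_eq_cube power4_eq_xxxx algebra_simps)
  qed simp
  then show "(\<Sum>i\<in>I. f i) = c 1"
    and "(\<Sum>i\<in>I. (f i)\<^sup>2) = (c 1)\<^sup>2 - 2 * c 2"
    and "(\<Sum>i\<in>I. f i ^ 3) = c 1 ^ 3 - 3 * c 1 * c 2 + 3 * c 3"
    and "(\<Sum>i\<in>I. f i ^ 4) = c 1 ^ 4 - 4 * (c 1)\<^sup>2 * c 2 + 2 * (c 2)\<^sup>2 + 4 * c 1 * c 3 - 4 * c 4"
    by blast+
qed

lemma coeff_prod_linear_bound:
  fixes f :: "'i \<Rightarrow> real"
  assumes "finite I" and "\<And>i. i \<in> I \<Longrightarrow> \<bar>f i\<bar> \<le> M" and "0 \<le> M"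
  shows "\<bar>coeff (\<Prod>i\<in>I. [:1, f i:]) k\<bar> \<le> 2 ^ card I * M ^ k"
  using assms(1,2)
proof (induction I arbitrary: k rule: finite_induct)
  case empty
  then show ?case using assms(3) by (cases k) auto
next
  case (insert a I)
  define h where "h = (\<Prod>i\<in>I. [:1, f i:])"
  have P: "(\<Prod>i\<in>insert a I. [:1, f i:]) = [:1, f a:] * h"
    unfolding h_def using insert.hyps by simp
  have IH: "\<bar>coeff h j\<bar> \<le> 2 ^ card I * M ^ j" for j
    unfolding h_def using insert.IH insert.prems by simp
  show ?case
  proof (cases k)
    case 0
    then show ?thesis
      using coeff_prod_linear_0[of "insert a I" f] insert.hyps(1) by simp
  next
    case (Suc j)
    have "\<bar>f a * coeff h j\<bar> \<le> M * (2 ^ card I * M ^ j)"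
      unfolding abs_mult using insert.prems[of a] IH[of j] assms(3) by (intro mult_mono) auto
    with IH[of k] have "\<bar>coeff h k + f a * coeff h j\<bar> \<le> 2 ^ Suc (card I) * M ^ k"
      unfolding Suc by (simp add: algebra_simps)
    then show ?thesis
      unfolding P Suc coeff_linear_mult_Suc using insert.hyps by simp
  qed
qed

text \<open>Only entry j may be large, and each monomial contains it at most once; this costs a
  single power of M.\<close>

lemma coeff_prod_linear_bound_except:
  fixes f :: "'i \<Rightarrow> real"
  assumes "finite I" and "j \<in> I" and "\<bar>f j\<bar> \<le> L"
    and "\<And>i. i \<in> I \<Longrightarrow> i \<noteq> j \<Longrightarrow> \<bar>f i\<bar> \<le> M" and "0 \<le> M"
  shows "\<bar>coeff (\<Prod>i\<in>I. [:1, f i:]) (Suc k)\<bar> \<le> 2 ^ card I * (M + L) * M ^ k"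
proof -
  define h where "h = (\<Prod>i\<in>I - {j}. [:1, f i:])"
  have P: "(\<Prod>i\<in>I. [:1, f i:]) = [:1, f j:] * h"
    unfolding h_def using assms(1,2) by (simp add: prod.remove)
  have h: "\<bar>coeff h l\<bar> \<le> 2 ^ card I * M ^ l" for l
  proof -
    have "\<bar>coeff h l\<bar> \<le> 2 ^ card (I - {j}) * M ^ l"
      unfolding h_def using assms by (intro coeff_prod_linear_bound) auto
    also have "\<dots> \<le> 2 ^ card I * M ^ l"
      using assms(1,5) by (intro mult_right_mono power_increasing card_mono) auto
    finally show ?thesis .
  qed
  have "\<bar>f j * coeff h k\<bar> \<le> L * (2 ^ card I * M ^ k)"
    unfolding abs_mult using assms(3) h[of k] by (intro mult_mono) auto
  then show ?thesis
    unfolding P coeff_linear_mult_Suc using h[of "Suc k"] by (simp add: algebra_simps)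
qed

subsection \<open>Existence and uniqueness of the eigenvalue vector\<close>

text \<open>Negated and read along the sorted indices, the entries form an increasing list, which
  its multiset determines.\<close>

lemma decreasing_vectors_unique:
  fixes u v :: "real^('d::{finite,linorder})"
  assumes "u \<in> decreasing_vectors" "v \<in> decreasing_vectors"
    and "image_mset (($) u) (mset_set UNIV) = image_mset (($) v) (mset_set UNIV)"
  shows "u = v"
proof -
  let ?xs = "sorted_list_of_set (UNIV :: 'd set)"
  have xs: "sorted ?xs" "set ?xs = UNIV" "mset ?xs = mset_set UNIV"
    by simp_all (metis mset_sorted_list_of_multiset sorted_list_of_mset_set)
  have sorted: "sorted (map (\<lambda>i. - w $ i) ?xs)" if "w \<in> decreasing_vectors" for w :: "real^('d::{finite,linorder})"
    unfolding sorted_map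
    by (rule sorted_wrt_mono_rel[OF _ xs(1)]) (use that in \<open>simp add: decreasing_vectors_def\<close>)
  have "mset (map (\<lambda>i. - u $ i) ?xs) = mset (map (\<lambda>i. - v $ i) ?xs)"
    using arg_cong[OF assms(3), of "image_mset uminus"] xs(3)
    by (simp add: image_mset.compositionality comp_def)
  then have "map (\<lambda>i. - u $ i) ?xs = map (\<lambda>i. - v $ i) ?xs"
    using properties_for_sort sorted assms(1,2) by metis
  then have "- u $ i = - v $ i" for i
    using xs(2) by (simp only: map_eq_conv) blast
  then show ?thesis by (simp add: vec_eq_iff)
qed

lemma decreasing_vector_exists:
  fixes M :: "real multiset"
  assumes "size M = CARD('d::{finite,linorder})"
  obtains u :: "real^('d::{finite,linorder})" where "u \<in> decreasing_vectors"
    and "image_mset (($) u) (mset_set UNIV) = M"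
proof -
  let ?xs = "sorted_list_of_set (UNIV :: 'd set)"
  let ?ys = "rev (sorted_list_of_multiset M)"
  have ys: "mset ?ys = M" "length ?ys = CARD('d)"
    using assms by (simp_all flip: size_mset)
  \<comment> \<open>\<open>rk\<close> numbers the indices from 0, matching positions in the
    decreasing list \<open>?ys\<close>.\<close>
  define rk where "rk i = card {..<i::'d}" for i
  define u :: "real^('d::{finite,linorder})" where "u = (\<chi> i. ?ys ! rk i)"
  have rk_less: "rk i < CARD('d)" for i
    unfolding rk_def by (rule psubset_card_mono) auto
  have rk_mono: "rk i < rk j" if "i < j" for i j
    unfolding rk_def using that by (intro psubset_card_mono) auto
  have inj: "inj rk"
    by (rule linorder_injI) (use rk_mono in fastforce)
  have bij: "bij_betw rk UNIV {..<CARD('d)}"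
    unfolding bij_betw_def
  proof
    show "range rk = {..<CARD('d)}"
      by (rule card_subset_eq) (use rk_less inj in \<open>auto simp: card_image\<close>)
  qed (rule inj)
  have "u \<in> decreasing_vectors"
  proof -
    have "?ys ! rk j \<le> ?ys ! rk i" if "i \<le> j" for i j
    proof -
      have "rk i \<le> rk j" using that by (auto simp: le_less dest: rk_mono)
      then show ?thesis
        using rk_less[of j] ys(2)
        by (intro sorted_rev_nth_mono) (simp_all only: rev_rev_ident sorted_sorted_list_of_multiset)
    qed
    then show ?thesis
      unfolding u_def decreasing_vectors_def by simp
  qed
  moreover have "image_mset (($) u) (mset_set UNIV) = M"
  proof -
    have "($) u = (!) ?ys \<circ> rk"
      by (simp add: u_def fun_eq_iff)
    then have "image_mset (($) u) (mset_set UNIV) = image_mset ((!) ?ys) (image_mset rk (mset_set UNIV))"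
      by (simp only: image_mset.compositionality)
    also have "image_mset rk (mset_set UNIV) = mset_set {..<CARD('d)}"
      by (metis bij bij_betw_def image_mset_mset_set)
    also have "image_mset ((!) ?ys) \<dots> = mset (map ((!) ?ys) [0..<length ?ys])"
      unfolding ys(2) mset_map mset_upt atLeast0LessThan ..
    also have "\<dots> = M"
      unfolding map_nth by (rule ys)
    finally show ?thesis .
  qed
  ultimately show ?thesis by (rule that)
qed

section \<open>Homogeneous polynomials along lines and curves\<close>

lemma homogeneous_polynomial_scale:
  assumes "homogeneous_polynomial d p"
  shows "p (r *\<^sub>R x) = r ^ d * p x"
proof -
  obtain c where c: "\<And>x. p x = (\<Sum>\<alpha> | (\<Sum>i\<in>UNIV. \<alpha> i) = d. c \<alpha> * (\<Prod>i\<in>UNIV. (x $ i) ^ \<alpha> i))"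
    using assms unfolding homogeneous_polynomial_def by blast
  show ?thesis
    unfolding c sum_distrib_left
    by (rule sum.cong) (auto simp: power_mult_distrib prod.distrib simp flip: power_sum)
qed

text \<open>The outer variable is t and the coefficients are polynomials in s, so that the
  coefficient of a power of t can be read off as a polynomial in s.\<close>

lemma homogeneous_polynomial_curve:
  fixes q :: "'n::finite \<Rightarrow> real poly poly"
  assumes "homogeneous_polynomial d p"
  obtains Q where "\<And>s t. poly (poly Q [:t:]) s = p (\<chi> i. poly (poly (q i) [:t:]) s)"
proof -
  obtain c where c: "\<And>x. p x = (\<Sum>\<alpha> | (\<Sum>i\<in>UNIV. \<alpha> i) = d. c \<alpha> * (\<Prod>i\<in>UNIV. (x $ i) ^ \<alpha> i))"
    using assms unfolding homogeneous_polynomial_def by blast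
  show ?thesis
    by (rule that[of "\<Sum>\<alpha> | (\<Sum>i\<in>UNIV. \<alpha> i) = d. [:[:c \<alpha>:]:] * (\<Prod>i\<in>UNIV. q i ^ \<alpha> i)"])
      (simp add: c poly_sum poly_prod)
qed

lemma homogeneous_polynomial_line:
  assumes "homogeneous_polynomial d p"
  obtains Q where "\<And>s. poly Q s = p (x + s *\<^sub>R y)"
proof -
  obtain Q where "\<And>s t. poly (poly Q [:t:]) s = p (\<chi> i. poly (poly [:[:x $ i, y $ i:]:] [:t:]) s)"
    using homogeneous_polynomial_curve[OF assms, of "\<lambda>i. [:[:x $ i, y $ i:]:]"] by blast
  moreover have "(\<chi> i. poly (poly [:[:x $ i, y $ i:]:] [:t:]) s) = x + s *\<^sub>R y" for s t
    by (simp add: vec_eq_iff)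
  ultimately show ?thesis
    using that[of "poly Q [:0:]"] by metis
qed

lemma poly_line_poly:
  assumes "homogeneous_polynomial d p"
  shows "poly (line_poly p e x) t = p (x - t *\<^sub>R e)"
proof -
  obtain Q where Q: "\<And>s. poly Q s = p (x + s *\<^sub>R - e)"
    using homogeneous_polynomial_line[OF assms, of x "- e"] by blast
  have "\<exists>!q. \<forall>t. poly q t = p (x - t *\<^sub>R e)"
    by (rule ex1I[of _ Q]) (auto simp: Q simp flip: poly_eq_poly_eq_iff)
  from theI'[OF this] show ?thesis
    unfolding line_poly_def by (rule spec)
qed

lemma proots_prod_linear:
  fixes u :: "'i \<Rightarrow> real"
  assumes "finite I"
  shows "proots (\<Prod>i\<in>I. [:u i, - 1:]) = image_mset u (mset_set I)"
  using assms
proof (induction I rule: finite_induct)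
  case (insert a I)
  have "proots [:u a, - 1:] = {#u a#}"
    using proots_uminus[of "[:- u a, 1:]"] by simp
  moreover have "(\<Prod>i\<in>I. [:u i, - 1:]) \<noteq> 0"
    using insert.hyps(1) by auto
  ultimately show ?case
    using insert by (simp add: proots_mult del: mult_pCons_left)
qed simp

section \<open>Factorization of a hyperbolic polynomial along e\<close>

locale hyperbolic_polynomial =
  fixes p :: "real^'n \<Rightarrow> real" and e :: "real^'n"
    and dtype :: "'d::{finite,linorder} itself"
  assumes hyp: "hyperbolic CARD('d) p e"
begin

lemma hom: "homogeneous_polynomial CARD('d) p"
  using hyp unfolding hyperbolic_def by blast

lemma p_e_nz: "p e \<noteq> 0"
  using hyp unfolding hyperbolic_def by blast

text \<open>By homogeneity the coefficient of t^d is p (- e) = (-1)^d p e, which is nonzero.\<close>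

lemma degree_line_poly:
  shows "degree (line_poly p e x) = CARD('d)"
    and "lead_coeff (line_poly p e x) = (- 1) ^ CARD('d) * p e"
proof -
  let ?L = "line_poly p e x"
  obtain G where G: "\<And>s. poly G s = p (- e + s *\<^sub>R x)"
    using homogeneous_polynomial_line[OF hom, of "- e" x] by blast
  have L: "poly ?L s = p (x + s *\<^sub>R - e)" for s
    using poly_line_poly[OF hom] by simp
  note * = homogeneous_along_line[OF homogeneous_polynomial_scale[OF hom] L G]
  have "coeff ?L CARD('d) = (- 1) ^ CARD('d) * p e"
    using *(4) homogeneous_polynomial_scale[OF hom, of "- 1" e] by simp
  moreover from this show "degree ?L = CARD('d)"
    using *(1) le_degree[of ?L "CARD('d)"] p_e_nz by simp
  ultimately show "lead_coeff ?L = (- 1) ^ CARD('d) * p e"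
    by simp
qed

lemma eigenvalues_unique:
  fixes u :: "real^('d::{finite,linorder})"
  assumes "u \<in> decreasing_vectors" and "\<And>t. p (x - t *\<^sub>R e) = p e * (\<Prod>i\<in>UNIV. u $ i - t)"
  shows "eigenvalues p e x = u"
proof -
  have "line_poly p e x = smult (p e) (\<Prod>i\<in>UNIV. [:u $ i, - 1:])"
    by (simp add: poly_line_poly[OF hom] assms(2) poly_prod fun_eq_iff flip: poly_eq_poly_eq_iff)
  then have "proots (line_poly p e x) = image_mset (($) u) (mset_set UNIV)"
    using p_e_nz by (simp add: proots_prod_linear)
  with assms(1) show ?thesis
    unfolding eigenvalues_def
    by (intro the_equality) (auto intro: decreasing_vectors_unique)
qed

lemma eigenvalues_spec:
  shows "(eigenvalues p e x :: real^('d::{finite,linorder})) \<in> decreasing_vectors"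
    and "p (x - t *\<^sub>R e) = p e * (\<Prod>i\<in>UNIV. (eigenvalues p e x :: real^('d::{finite,linorder})) $ i - t)"
proof -
  let ?L = "line_poly p e x"
  have nz: "?L \<noteq> 0"
    using p_e_nz degree_line_poly(2)[of x]
    by (metis coeff_0 mult_eq_0_iff power_eq_0_iff zero_neq_neg_one)
  have real_rooted: "z \<in> \<real>" if "poly (map_poly complex_of_real ?L) z = 0" for z
    using hyp that unfolding hyperbolic_def by blast
  obtain M where "?L = smult (lead_coeff ?L) (\<Prod>a\<in>#M. [:- a, 1:])"
    using real_rooted_splits[OF nz real_rooted] by blast
  then have M: "?L = smult ((- 1) ^ CARD('d) * p e) (\<Prod>a\<in>#M. [:- a, 1:])"
    by (simp only: degree_line_poly(2))
  have "degree (\<Prod>a\<in>#N. [:- a, 1:]) = size N \<and> (\<Prod>a\<in>#N. [:- a, 1:]) \<noteq> 0" for N :: "real multiset"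
    by (induction N) (auto simp: degree_mult_eq simp del: mult_pCons_left)
  then have "size M = CARD('d)"
    using degree_line_poly(1)[of x] p_e_nz unfolding M by simp
  then obtain v :: "real^('d::{finite,linorder})" where v: "v \<in> decreasing_vectors"
    "image_mset (($) v) (mset_set UNIV) = M"
    using decreasing_vector_exists by blast
  have prod: "p (x - t *\<^sub>R e) = p e * (\<Prod>i\<in>UNIV. v $ i - t)" for t
  proof -
    have "p (x - t *\<^sub>R e) = (- 1) ^ CARD('d) * p e * poly (\<Prod>a\<in>#M. [:- a, 1:]) t"
      unfolding poly_line_poly[OF hom, symmetric] M by simp
    also have "poly (\<Prod>a\<in>#M. [:- a, 1:]) t = (\<Prod>i\<in>UNIV. t - v $ i)"
      unfolding v(2)[symmetric] image_mset.compositionality comp_def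
      by (simp add: poly_prod flip: prod_unfold_prod_mset)
    \<comment> \<open>The sign is distributed over the d factors, turning each t - a into a -
      t.\<close>
    also have "(- 1) ^ CARD('d) * p e * \<dots> = p e * (\<Prod>i\<in>UNIV. (- 1) * (t - v $ i))"
      by (simp only: prod.distrib) simp
    finally show ?thesis by simp
  qed
  have "eigenvalues p e x = v"
    using v(1) prod by (rule eigenvalues_unique)
  with v(1) prod show "(eigenvalues p e x :: real^('d::{finite,linorder})) \<in> decreasing_vectors"
    "p (x - t *\<^sub>R e) = p e * (\<Prod>i\<in>UNIV. (eigenvalues p e x :: real^('d::{finite,linorder})) $ i - t)"
    by simp_all
qed

end

text \<open>At least one of |a| and |1 - a| is 1/2 or more.\<close>

lemma near_0_or_1:
  fixes a :: real
  assumes "\<bar>a * (1 - a)\<bar> \<le> m"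
  shows "\<bar>a\<bar> \<le> 2 * m \<or> \<bar>1 - a\<bar> \<le> 2 * m"
proof (cases "\<bar>a\<bar> \<le> 1/2")
  case True
  then have "\<bar>a\<bar> * (1/2) \<le> \<bar>a\<bar> * \<bar>1 - a\<bar>"
    by (intro mult_left_mono) auto
  with assms show ?thesis by (simp add: abs_mult)
next
  case False
  then have "(1/2) * \<bar>1 - a\<bar> \<le> \<bar>a\<bar> * \<bar>1 - a\<bar>"
    by (intro mult_right_mono) auto
  with assms show ?thesis by (simp add: abs_mult)
qed

subsection \<open>The inner product of a hyperbolic polynomial\<close>

context hyperbolic_polynomial
begin

abbreviation lam :: "real^'n \<Rightarrow> real^('d::{finite,linorder})"
  where "lam \<equiv> eigenvalues p e"

text \<open>Generating polynomial of the elementary symmetric functions of the eigenvalues; by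
  \<open>p_shift\<close> it is r |-> p (e + r x) / p e.\<close>

definition esym_poly :: "real^'n \<Rightarrow> real poly"
  where "esym_poly x = (\<Prod>i\<in>UNIV. [:1, lam x $ i:])"

definition esym :: "nat \<Rightarrow> real^'n \<Rightarrow> real"
  where "esym k x = coeff (esym_poly x) k"

lemma p_shift: "p (e + r *\<^sub>R x) = p e * poly (esym_poly x) r"
proof (cases "r = 0")
  case True
  then show ?thesis by (simp add: esym_poly_def poly_prod)
next
  case False
  \<comment> \<open>The line is evaluated at t = -1/r; homogeneity then moves one factor r into each
    linear factor.\<close>
  then have "e + r *\<^sub>R x = r *\<^sub>R (x - (- 1 / r) *\<^sub>R e)"
    by (simp add: algebra_simps)
  then have "p (e + r *\<^sub>R x) = r ^ CARD('d) * (p e * (\<Prod>i\<in>UNIV. lam x $ i - (- 1 / r)))"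
    by (simp only: homogeneous_polynomial_scale[OF hom] eigenvalues_spec(2))
  also have "\<dots> = p e * (\<Prod>i\<in>UNIV. r * (lam x $ i - (- 1 / r)))"
    by (simp add: prod.distrib)
  also have "\<dots> = p e * poly (esym_poly x) r"
    using False by (simp add: esym_poly_def poly_prod algebra_simps)
  finally show ?thesis .
qed

text \<open>p (e + t (y + s z)) is polynomial in s and t jointly, and its coefficient of t^k is p e
  times \<open>esym k (y + s *\<^sub>R z)\<close>. Single eigenvalues need not be polynomial in
  s.\<close>

lemma esym_line:
  obtains g where "\<And>s. poly g s = esym k (y + s *\<^sub>R z)"
proof -
  define q :: "'n \<Rightarrow> real poly poly" where "q i = [:[:e $ i:], [:y $ i, z $ i:]:]" for i
  obtain Q where Q: "\<And>s t. poly (poly Q [:t:]) s = p (\<chi> i. poly (poly (q i) [:t:]) s)"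
    using homogeneous_polynomial_curve[OF hom, of q] by blast
  have "(\<chi> i. poly (poly (q i) [:t:]) s) = e + t *\<^sub>R (y + s *\<^sub>R z)" for s t
    by (simp add: q_def vec_eq_iff algebra_simps)
  with Q have Q': "poly (poly Q [:t:]) s = p e * poly (esym_poly (y + s *\<^sub>R z)) t" for s t
    by (simp only: p_shift)
  have swap: "poly (map_poly (\<lambda>f. poly f s) f) t = poly (poly f [:t:]) s" for f :: "real poly poly" and s t
    by (induction f) (auto simp: map_poly_pCons)
  have "map_poly (\<lambda>f. poly f s) Q = smult (p e) (esym_poly (y + s *\<^sub>R z))" for s
    by (simp add: swap Q' fun_eq_iff flip: poly_eq_poly_eq_iff)
  then have "poly (coeff Q k) s = p e * esym k (y + s *\<^sub>R z)" for s
    unfolding esym_def by (metis coeff_map_poly coeff_smult poly_0)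
  then show ?thesis
    using that[of "smult (inverse (p e)) (coeff Q k)"] p_e_nz by simp
qed

lemma esym_scale: "esym k (s *\<^sub>R x) = s ^ k * esym k x"
proof -
  have "p e * poly (esym_poly (s *\<^sub>R x)) r = p e * poly (esym_poly x) (s * r)" for r
    using p_shift[of r "s *\<^sub>R x"] p_shift[of "s * r" x] by (simp add: mult.commute)
  then have "esym_poly (s *\<^sub>R x) = esym_poly x \<circ>\<^sub>p [:0, s:]"
    using p_e_nz by (simp add: poly_pcompose fun_eq_iff mult.commute flip: poly_eq_poly_eq_iff)
  then show ?thesis
    by (simp add: esym_def coeff_pcompose_linear)
qed

lemma esym_0 [simp]: "esym 0 x = 1"
  by (simp add: esym_def esym_poly_def coeff_prod_linear_0)

lemma eigenvalue_power_sums: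
  shows "(\<Sum>i\<in>UNIV. lam x $ i) = esym 1 x"
    and "(\<Sum>i\<in>UNIV. (lam x $ i)\<^sup>2) = (esym 1 x)\<^sup>2 - 2 * esym 2 x"
    and "(\<Sum>i\<in>UNIV. lam x $ i ^ 3) = esym 1 x ^ 3 - 3 * esym 1 x * esym 2 x + 3 * esym 3 x"
    and "(\<Sum>i\<in>UNIV. lam x $ i ^ 4) = esym 1 x ^ 4 - 4 * (esym 1 x)\<^sup>2 * esym 2 x
           + 2 * (esym 2 x)\<^sup>2 + 4 * esym 1 x * esym 3 x - 4 * esym 4 x"
  unfolding esym_def esym_poly_def by (rule newton_power_sums; simp)+

section \<open>The squared norm as a quadratic form, and polarization\<close>

definition nsq :: "real^'n \<Rightarrow> real"
  where "nsq x = (hyp_norm TYPE('d) p e x)\<^sup>2"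

lemma nsq_lam: "nsq x = (norm (lam x))\<^sup>2"
  by (simp add: nsq_def hyp_norm_def)

lemma nsq_esym: "nsq x = (esym 1 x)\<^sup>2 - 2 * esym 2 x"
  unfolding eigenvalue_power_sums(2)[symmetric] nsq_lam
  by (simp add: norm_vec_def L2_set_def sum_nonneg)

lemma nsq_nonneg [simp]: "0 \<le> nsq x"
  by (simp add: nsq_def)

lemma nsq_scale: "nsq (s *\<^sub>R x) = s\<^sup>2 * nsq x"
  by (simp add: nsq_esym esym_scale power_mult_distrib algebra_simps)

lemma nsq_minus [simp]: "nsq (- x) = nsq x"
  using nsq_scale[of "- 1" x] by simp

lemma nsq_minus_commute: "nsq (x - y) = nsq (y - x)"
  using nsq_minus[of "x - y"] by simp

text \<open>The squared norm is polynomial on lines, and homogeneity of degree 2 bounds the degree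
  and fixes the outer coefficients.\<close>

lemma nsq_line:
  obtains b where "\<And>s. nsq (y + s *\<^sub>R z) = nsq y + s * b + s\<^sup>2 * nsq z"
proof -
  have line: "\<exists>f. \<forall>s. poly f s = nsq (y + s *\<^sub>R z)" for y z
  proof -
    obtain g h where "\<And>s. poly g s = esym 1 (y + s *\<^sub>R z)" "\<And>s. poly h s = esym 2 (y + s *\<^sub>R z)"
      using esym_line[of 1 y z] esym_line[of 2 y z] by metis
    then have "\<forall>s. poly (g\<^sup>2 - smult 2 h) s = nsq (y + s *\<^sub>R z)"
      by (simp add: nsq_esym)
    then show ?thesis by blast
  qed
  obtain f g where f: "\<And>s. poly f s = nsq (y + s *\<^sub>R z)" and g: "\<And>s. poly g s = nsq (z + s *\<^sub>R y)"
    using line[of y z] line[of z y] by blast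
  note * = homogeneous_along_line[OF nsq_scale f g]
  have "f = [:nsq y, coeff f 1, nsq z:]"
  proof (rule poly_eqI)
    fix n :: nat
    consider "n = 0" | "n = 1" | "n = 2" | m where "n = Suc (Suc (Suc m))"
      by (metis One_nat_def Suc_1 not0_implies_Suc)
    then show "coeff f n = coeff [:nsq y, coeff f 1, nsq z:] n"
      using *(1,3,4) by cases (auto simp: numeral_2_eq_2 coeff_eq_0)
  qed
  then have "poly f s = poly [:nsq y, coeff f 1, nsq z:] s" for s
    by (rule arg_cong)
  then have "nsq (y + s *\<^sub>R z) = nsq y + s * coeff f 1 + s\<^sup>2 * nsq z" for s
    unfolding f by (simp add: power2_eq_square algebra_simps)
  then show ?thesis by (rule that)
qed

lemma parallelogram: "nsq (y + z) + nsq (y - z) = 2 * nsq y + 2 * nsq z"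
proof -
  obtain b where "\<And>s. nsq (y + s *\<^sub>R z) = nsq y + s * b + s\<^sup>2 * nsq z"
    using nsq_line by blast
  from this[of 1] this[of "- 1"] show ?thesis by simp
qed

definition ip :: "real^'n \<Rightarrow> real^'n \<Rightarrow> real"
  where "ip x y = hyp_inner TYPE('d) p e x y"

lemma ip_nsq: "4 * ip x y = nsq (x + y) - nsq (x - y)"
  by (simp add: ip_def hyp_inner_def nsq_def)

lemma nsq_add: "nsq (x + y) = nsq x + nsq y + 2 * ip x y"
  using ip_nsq[of x y] parallelogram[of x y] by simp

lemma nsq_diff: "nsq (x - y) = nsq x + nsq y - 2 * ip x y"
  using ip_nsq[of x y] parallelogram[of x y] by simp

lemma ip_commute: "ip x y = ip y x"
  using ip_nsq[of x y] ip_nsq[of y x] nsq_minus_commute[of x y] by (simp add: add.commute)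

text \<open>The expansion at r and -r gives 2 r b with b independent of r, which covers all real
  scalars at once.\<close>

lemma ip_scale: "ip (s *\<^sub>R x) y = s * ip x y"
proof -
  obtain b where b: "\<And>s. nsq (y + s *\<^sub>R x) = nsq y + s * b + s\<^sup>2 * nsq x"
    using nsq_line by blast
  have "4 * ip (r *\<^sub>R x) y = 2 * r * b" for r
    using b[of r] b[of "- r"] ip_nsq[of y "r *\<^sub>R x"] by (simp add: ip_commute)
  from this[of s] this[of 1] show ?thesis unfolding scaleR_one by algebra
qed

text \<open>The Jordan-von Neumann argument: combining the four parallelogram identities, mixed
  terms such as \<open>nsq (x + z - y)\<close> cancel because \<open>nsq\<close> is even.\<close>

lemma ip_add: "ip (x + y) z = ip x z + ip y z"
  using parallelogram[of "x + z" y] parallelogram[of "x - z" y]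
    parallelogram[of "y + z" x] parallelogram[of "y - z" x]
    nsq_minus_commute[of "x + z" y] nsq_minus_commute[of "y + z" x]
    ip_nsq[of x z] ip_nsq[of y z] ip_nsq[of "x + y" z]
  by (simp add: algebra_simps)

lemma ip_sum: "ip (\<Sum>i\<in>I. a i *\<^sub>R f i) z = (\<Sum>i\<in>I. a i * ip (f i) z)"
proof -
  have "ip 0 z = 0"
    using ip_scale[of 0 0 z] by simp
  then show ?thesis
    by (induction I rule: infinite_finite_induct) (simp_all add: ip_add ip_scale)
qed

subsection \<open>Rank-one elements\<close>

text \<open>Stated through the generating polynomial, this can be checked from values of
  \<open>p\<close> without ordering eigenvalues.\<close>

definition rank_one :: "real^'n \<Rightarrow> bool"
  where "rank_one c \<longleftrightarrow> esym_poly c = [:1, 1:]"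

lemma rank_one_esym:
  assumes "rank_one c"
  shows "esym 1 c = 1" and "2 \<le> k \<Longrightarrow> esym k c = 0"
  using assms by (auto simp: rank_one_def esym_def coeff_pCons split: nat.split)

lemma esym_1_line: "esym 1 (y + s *\<^sub>R z) = esym 1 y + s * esym 1 z"
proof -
  obtain f g where f: "\<And>s. poly f s = esym 1 (y + s *\<^sub>R z)" and g: "\<And>s. poly g s = esym 1 (z + s *\<^sub>R y)"
    using esym_line[of 1 y z] esym_line[of 1 z y] by metis
  note * = homogeneous_along_line[OF esym_scale f g]
  have "poly f s = (\<Sum>i\<le>1. coeff f i * s ^ i)"
    unfolding poly_altdef using *(1) by (intro sum.mono_neutral_left) (auto simp: coeff_eq_0)
  then show ?thesis
    using *(3,4) f by simp
qed

text \<open>The sum of the squares of \<open>\<lambda>\<^sub>i (1 - \<lambda>\<^sub>i)\<close> is symmetric in the eigenvalues, hence a polynomial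
  in \<open>s\<close>; it is nonnegative and vanishes at \<open>s = 0\<close>, so it is \<open>O(s\<^sup>2)\<close>.\<close>

lemma rank_one_perturbation_gap:
  assumes c: "rank_one c"
  obtains C where "0 < C"
    and "\<And>s i. \<bar>s\<bar> \<le> 1 \<Longrightarrow> \<bar>lam (c + s *\<^sub>R z) $ i * (1 - lam (c + s *\<^sub>R z) $ i)\<bar> \<le> C * \<bar>s\<bar>"
proof -
  define Z where "Z x = (\<Sum>i\<in>UNIV. (lam x $ i * (1 - lam x $ i))\<^sup>2)" for x
  have Z: "Z x = (\<Sum>i\<in>UNIV. (lam x $ i)\<^sup>2) - 2 * (\<Sum>i\<in>UNIV. lam x $ i ^ 3) + (\<Sum>i\<in>UNIV. lam x $ i ^ 4)" for x
    unfolding Z_def sum_distrib_left sum_subtractf[symmetric] sum.distrib[symmetric]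
    by (rule sum.cong) (auto simp: power2_eq_square power3_eq_cube power4_eq_xxxx algebra_simps)
  have "\<exists>g. \<forall>s. poly g s = esym k (c + s *\<^sub>R z)" for k
    using esym_line by metis
  then obtain g where g: "\<And>k s. poly (g k) s = esym k (c + s *\<^sub>R z)"
    by metis
  \<comment> \<open>The sum of squares is p_2 - 2 p_3 + p_4 in power sums; each is expanded by
    Newton's identities.\<close>
  define h where "h = (g 1)\<^sup>2 - 2 * g 2 - 2 * (g 1 ^ 3 - 3 * g 1 * g 2 + 3 * g 3)
    + (g 1 ^ 4 - 4 * (g 1)\<^sup>2 * g 2 + 2 * (g 2)\<^sup>2 + 4 * g 1 * g 3 - 4 * g 4)"
  have h: "poly h s = Z (c + s *\<^sub>R z)" for s
    unfolding Z eigenvalue_power_sums h_def by (simp add: g)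
  have "poly h 0 = 0"
    unfolding h Z eigenvalue_power_sums using rank_one_esym[OF c] by simp
  moreover have "0 \<le> poly h s" for s
    unfolding h Z_def by (simp add: sum_nonneg)
  ultimately obtain C where "0 < C" and C: "\<And>s. \<bar>s\<bar> \<le> 1 \<Longrightarrow> poly h s \<le> (C * s)\<^sup>2"
    using poly_nonneg_double_root by blast
  show ?thesis
  proof (rule that[OF \<open>0 < C\<close>])
    fix s :: real and i
    assume "\<bar>s\<bar> \<le> 1"
    let ?l = "lam (c + s *\<^sub>R z) $ i"
    have "(?l * (1 - ?l))\<^sup>2 \<le> Z (c + s *\<^sub>R z)"
      unfolding Z_def by (rule member_le_sum) auto
    also have "\<dots> \<le> (C * s)\<^sup>2"
      using C[OF \<open>\<bar>s\<bar> \<le> 1\<close>] unfolding h .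
    finally show "\<bar>?l * (1 - ?l)\<bar> \<le> C * \<bar>s\<bar>"
      using \<open>0 < C\<close> unfolding abs_le_square_iff[symmetric] by (simp add: abs_mult)
  qed
qed

text \<open>Every eigenvalue of c + s z lies within M = 2 C |s| of 0 or 1. The trace 1 + s leaves
  room for only one near 1, so all but one are O(s).\<close>

lemma rank_one_perturbation_esym:
  assumes c: "rank_one c" and z: "rank_one z"
  obtains \<delta> K where "0 < \<delta>"
    and "\<And>s. \<bar>s\<bar> < \<delta> \<Longrightarrow> \<bar>esym (Suc k) (c + s *\<^sub>R z)\<bar> \<le> K * \<bar>s\<bar> ^ k"
proof -
  obtain C where "0 < C" and gap: "\<And>s i. \<bar>s\<bar> \<le> 1 \<Longrightarrow>
      \<bar>lam (c + s *\<^sub>R z) $ i * (1 - lam (c + s *\<^sub>R z) $ i)\<bar> \<le> C * \<bar>s\<bar>"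
    using rank_one_perturbation_gap[OF c] by metis
  let ?d = "CARD('d)"
  \<comment> \<open>Chosen so that |s| < \<delta> means d M + |s| < 1.\<close>
  define \<delta> where "\<delta> = 1 / (2 * C * ?d + 1)"
  have d1: "1 \<le> real ?d"
    by (simp add: Suc_leI)
  have "0 < 2 * C * ?d + 1"
    using \<open>0 < C\<close> by (intro add_nonneg_pos) auto
  then have "0 < \<delta>" by (simp add: \<delta>_def)
  moreover have "\<bar>esym (Suc k) (c + s *\<^sub>R z)\<bar> \<le> (2 ^ ?d * 3 * (2 * C) ^ k) * \<bar>s\<bar> ^ k" if "\<bar>s\<bar> < \<delta>" for s
  proof -
    define l where "l = lam (c + s *\<^sub>R z)"
    define M where "M = 2 * C * \<bar>s\<bar>"
    have "\<bar>s\<bar> * (2 * C * ?d + 1) < 1"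
      using that \<open>0 < 2 * C * ?d + 1\<close> by (simp add: \<delta>_def pos_less_divide_eq)
    then have M: "?d * M + \<bar>s\<bar> < 1"
      by (simp add: M_def algebra_simps)
    have "0 \<le> M" using \<open>0 < C\<close> by (simp add: M_def)
    then have "M \<le> ?d * M"
      using mult_right_mono[OF d1] by simp
    with M have "\<bar>s\<bar> \<le> 1" "M \<le> 1" using \<open>0 \<le> M\<close> by linarith+
    then have split: "\<bar>l $ i\<bar> \<le> M \<or> \<bar>1 - l $ i\<bar> \<le> M" for i
      using near_0_or_1[OF gap, of s i] by (simp add: l_def M_def mult.assoc)
    have trace: "(\<Sum>i\<in>UNIV. l $ i) = 1 + s"
      unfolding l_def eigenvalue_power_sums esym_1_line
      using rank_one_esym(1)[OF c] rank_one_esym(1)[OF z] by simp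
    \<comment> \<open>All eigenvalues are at least -M, so two of them near 1 would push the trace up
      to 2 - d M, beyond 1 + s.\<close>
    have single: "i = j" if "\<not> \<bar>l $ i\<bar> \<le> M" "\<not> \<bar>l $ j\<bar> \<le> M" for i j
    proof (rule ccontr)
      assume "i \<noteq> j"
      have "0 \<le> l $ k + M" for k
        using split[of k] \<open>M \<le> 1\<close> \<open>0 \<le> M\<close> by auto
      then have "(\<Sum>k\<in>{i, j}. l $ k + M) \<le> (\<Sum>k\<in>UNIV. l $ k + M)"
        by (intro sum_mono2) auto
      also have "\<dots> = 1 + s + ?d * M"
        by (simp add: sum.distrib trace)
      finally have "l $ i + l $ j + 2 * M \<le> 1 + s + ?d * M"
        using \<open>i \<noteq> j\<close> by simp
      then show False
        using M split[of i] split[of j] that by auto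
    qed
    \<comment> \<open>If no eigenvalue is near 1, any index serves as j.\<close>
    obtain j where j: "\<And>i. i \<noteq> j \<Longrightarrow> \<bar>l $ i\<bar> \<le> M"
      using single by metis
    have "\<bar>l $ j\<bar> \<le> 2"
      using split[of j] \<open>M \<le> 1\<close> by auto
    then have "\<bar>esym (Suc k) (c + s *\<^sub>R z)\<bar> \<le> 2 ^ ?d * (M + 2) * M ^ k"
      unfolding esym_def esym_poly_def l_def[symmetric] using j \<open>0 \<le> M\<close>
      by (intro coeff_prod_linear_bound_except[where j = j]) auto
    also have "\<dots> \<le> 2 ^ ?d * 3 * M ^ k"
      using \<open>M \<le> 1\<close> \<open>0 \<le> M\<close> by (intro mult_right_mono mult_left_mono) auto
    finally show ?thesis
      by (simp add: M_def power_mult_distrib)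
  qed
  ultimately show ?thesis by (rule that)
qed

text \<open>As a polynomial in \<open>s\<close>, \<^term>\<open>esym k (c + s *\<^sub>R z)\<close> has no terms below degree \<open>k - 1\<close>; exchanging
  the roles of \<open>c\<close> and \<open>z\<close> reverses its coefficients, so it has none above degree \<open>1\<close> either.\<close>

lemma rank_one_sum_esym:
  assumes c: "rank_one c" and z: "rank_one z" and "3 \<le> k"
  shows "esym k (c + z) = 0"
proof -
  obtain m where m: "k = Suc m" "2 \<le> m"
    using assms(3) by (cases k) auto
  have low: "coeff f j = 0"
    if a: "rank_one a" and b: "rank_one b" and j: "j < m" and f: "\<And>s. poly f s = esym k (a + s *\<^sub>R b)" for f a b j
  proof -
    obtain \<delta> K where "0 < \<delta>" "\<And>s. \<bar>s\<bar> < \<delta> \<Longrightarrow> \<bar>esym (Suc m) (a + s *\<^sub>R b)\<bar> \<le> K * \<bar>s\<bar> ^ m"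
      using rank_one_perturbation_esym[OF a b] by metis
    then show ?thesis
      using poly_small_coeff_0[of \<delta> f K m j] j unfolding f m(1) by blast
  qed
  obtain f g where f: "\<And>s. poly f s = esym k (c + s *\<^sub>R z)" and g: "\<And>s. poly g s = esym k (z + s *\<^sub>R c)"
    using esym_line[of k c z] esym_line[of k z c] by metis
  note * = homogeneous_along_line[OF esym_scale f g]
  have "coeff f j = 0" for j
  proof -
    consider "j < m" | "m \<le> j" "j \<le> k" | "k < j" by linarith
    then show ?thesis
    proof cases
      case 1
      then show ?thesis using low[OF c z _ f] by simp
    next
      case 2
      \<comment> \<open>Here k - j is at most 1, and 1 < m is where k >= 3 enters.\<close>
      then have "k - j < m" using m by linarith
      with 2 show ?thesis using low[OF z c _ g] *(2) by simp
    next
      case 3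
      then show ?thesis using *(1) by (simp add: coeff_eq_0)
    qed
  qed
  then have "f = 0" by (intro poly_eqI) simp
  then show ?thesis using f[of 1] by simp
qed

lemma rank_one_ip_nonneg:
  assumes c: "rank_one c" and z: "rank_one z"
  shows "0 \<le> ip c z"
proof -
  define m where "m = esym 2 (c + z)"
  have e1: "esym 1 (c + z) = 2"
    using esym_1_line[of c 1 z] rank_one_esym(1)[OF c] rank_one_esym(1)[OF z] by simp
  have P: "esym_poly (c + z) = [:1, 2, m:]"
  proof (rule poly_eqI)
    fix n :: nat
    consider "n = 0" | "n = 1" | "n = 2" | "3 \<le> n" by linarith
    then show "coeff (esym_poly (c + z)) n = coeff [:1, 2, m:] n"
      using rank_one_sum_esym[OF c z, of n] e1 esym_0[of "c + z"]
      by cases (auto simp: m_def esym_def numeral_2_eq_2 coeff_eq_0)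
  qed
  have "m \<le> 1"
  proof (rule ccontr)
    assume "\<not> m \<le> 1"
    \<comment> \<open>For m > 1 the polynomial (1 + r)^2 + (m - 1) r^2 has no real zero, but a
      nonzero eigenvalue a would give the zero -1/a. All eigenvalues then vanish, against trace
      2.\<close>
    have "lam (c + z) $ i = 0" for i
    proof (rule ccontr)
      assume nz: "lam (c + z) $ i \<noteq> 0"
      define r where "r = - 1 / lam (c + z) $ i"
      have "poly [:1, lam (c + z) $ i:] r = 0"
        using nz by (simp add: r_def)
      then have "poly (esym_poly (c + z)) r = 0"
        unfolding esym_poly_def poly_prod by (intro prod_zero) auto
      then have "(1 + r)\<^sup>2 + (m - 1) * r\<^sup>2 = 0"
        unfolding P by (simp add: power2_eq_square algebra_simps)
      moreover have "0 < (m - 1) * r\<^sup>2"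
        using \<open>\<not> m \<le> 1\<close> nz by (simp add: r_def)
      ultimately show False
        using zero_le_power2[of "1 + r"] by linarith
    qed
    then show False
      using eigenvalue_power_sums(1)[of "c + z"] e1 by simp
  qed
  then show ?thesis
    using nsq_add[of c z] e1 rank_one_esym[OF c] rank_one_esym[OF z]
    by (simp add: nsq_esym m_def)
qed

end

subsection \<open>Diagonalizable polynomials\<close>

text \<open>An interior point of the cone of decreasing vectors: the entries are d-1, ..., 1,
  0.\<close>

definition staircase :: "real^('d::{finite,linorder})"
  where "staircase = (\<chi> i. real (card {i<..}))"

text \<open>Two entries of u differ by at most 2 \<open>norm u\<close>, while the staircase term
  separates them by at least r.\<close>

lemma eventually_decreasing:
  fixes u :: "real^('d::{finite,linorder})"
  assumes "2 * norm u \<le> r"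
  shows "u + r *\<^sub>R staircase \<in> decreasing_vectors"
proof -
  have "(u + r *\<^sub>R staircase) $ j \<le> (u + r *\<^sub>R staircase) $ i" if "i < j" for i j
  proof -
    have "card {j<..} < card {i<..}"
      using that by (intro psubset_card_mono) auto
    then have "1 \<le> staircase $ i - (staircase $ j :: real)"
      by (simp add: staircase_def)
    moreover have "0 \<le> r" using assms norm_ge_zero[of u] by linarith
    ultimately have "r \<le> r * (staircase $ i - staircase $ j)"
      by (metis mult.right_neutral mult_left_mono)
    moreover have "u $ j - u $ i \<le> r"
      using assms component_le_norm_cart[of u i] component_le_norm_cart[of u j] by linarith
    ultimately show ?thesis by (simp add: algebra_simps)
  qed
  then show ?thesis
    unfolding decreasing_vectors_def by (auto simp: le_less)
qed

text \<open>Every vector is a difference of two decreasing ones. Hence the conditions on \<Delta>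
  will hold on the whole space.\<close>

lemma span_decreasing_vectors: "span (decreasing_vectors :: (real^('d::{finite,linorder})) set) = UNIV"
proof -
  have "u \<in> span decreasing_vectors" for u :: "real^('d::{finite,linorder})"
  proof -
    let ?r = "2 * norm u"
    have "u = (u + ?r *\<^sub>R staircase) - (0 + ?r *\<^sub>R staircase)"
      by simp
    also have "\<dots> \<in> span decreasing_vectors"
      by (intro span_diff span_base eventually_decreasing) auto
    finally show ?thesis .
  qed
  then show ?thesis by blast
qed

lemma closest_point_nonneg_orthant:
  "closest_point nonneg_orthant u = (\<chi> i. max 0 (u $ i))" for u :: "real^'d"
proof (rule sym, rule closest_point_unique)
  show "convex (nonneg_orthant :: (real^'d) set)"
    unfolding convex_def nonneg_orthant_def by simp
  have "nonneg_orthant = (\<Inter>i. {u :: real^'d. 0 \<le> u $ i})"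
    by (auto simp: nonneg_orthant_def)
  moreover have "closed (\<Inter>i. {u :: real^'d. 0 \<le> u $ i})"
    by (intro closed_INT ballI closed_Collect_le continuous_intros)
  ultimately show "closed (nonneg_orthant :: (real^'d) set)"
    by simp
  show "(\<chi> i. max 0 (u $ i)) \<in> nonneg_orthant"
    by (simp add: nonneg_orthant_def)
  show "\<forall>z\<in>nonneg_orthant. dist u (\<chi> i. max 0 (u $ i)) \<le> dist u z"
  proof
    fix z :: "real^'d"
    assume "z \<in> nonneg_orthant"
    then have z: "0 \<le> z $ i" for i
      by (simp add: nonneg_orthant_def)
    have "\<bar>(u - (\<chi> i. max 0 (u $ i))) $ i\<bar> \<le> \<bar>(u - z) $ i\<bar>" for i
      using z[of i] by (cases "0 \<le> u $ i") auto
    then show "dist u (\<chi> i. max 0 (u $ i)) \<le> dist u z"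
      unfolding dist_norm by (intro norm_le_componentwise_cart) (simp only: real_norm_def)
  qed
qed

section \<open>The diagonal map and its isometric images\<close>

locale diagonalized_polynomial = hyperbolic_polynomial p e dtype
  for p :: "real^'n \<Rightarrow> real" and e and dtype :: "'d::{finite,linorder} itself" +
  fixes \<Delta> :: "real^('d::{finite,linorder}) \<Rightarrow> real^'n"
  assumes complete: "complete_hyperbolic TYPE('d) p e"
    and diagonalizable: "diagonalizable_by p e \<Delta>"
    and range_lam: "range lam = decreasing_vectors"
begin

definition isometries :: "(real^'n \<Rightarrow> real^'n) set"
  where "isometries = eigenvalue_isometries TYPE('d) p e"

lemma lam_0_iff: "lam x = 0 \<longleftrightarrow> x = 0"
  using complete unfolding complete_hyperbolic_def by blast

lemma linear_diag: "linear \<Delta>"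
  using diagonalizable unfolding diagonalizable_by_def Let_def range_lam span_decreasing_vectors
  by (intro linearI) auto

lemma nsq_diag: "nsq (\<Delta> u) = (norm u)\<^sup>2"
  using diagonalizable unfolding diagonalizable_by_def Let_def range_lam span_decreasing_vectors nsq_def
  by auto

lemma isometry_linear: "A \<in> isometries \<Longrightarrow> linear A"
  unfolding isometries_def eigenvalue_isometries_def by blast

lemma lam_isometry: "A \<in> isometries \<Longrightarrow> lam (A x) = lam x"
  unfolding isometries_def eigenvalue_isometries_def by auto

lemma diagonalize:
  obtains A where "A \<in> isometries" "x = A (\<Delta> (lam x))"
  using diagonalizable unfolding diagonalizable_by_def isometries_def by blast

text \<open>The range assumption makes u the eigenvalue vector of some x, and the isometry taking
  \<Delta> u to x preserves eigenvalues.\<close>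

lemma lam_diag:
  assumes "u \<in> decreasing_vectors"
  shows "lam (\<Delta> u) = u"
proof -
  obtain x where u: "u = lam x"
    using assms range_lam by (metis imageE)
  obtain A where "A \<in> isometries" "x = A (\<Delta> (lam x))"
    using diagonalize .
  then show ?thesis
    unfolding u using lam_isometry by metis
qed

text \<open>For decreasing \<open>u\<close> this is \<open>lam_diag\<close>; every line in direction \<^term>\<open>staircase\<close> eventually enters
  the decreasing vectors, so the polynomial identity extends to all \<open>u\<close>.\<close>

lemma p_diag: "p (\<Delta> u) = p e * (\<Prod>i\<in>UNIV. u $ i)"
proof -
  obtain f where f: "\<And>s. poly f s = p (\<Delta> u + s *\<^sub>R \<Delta> staircase)"
    using homogeneous_polynomial_line[OF hom] by blast
  have "f = smult (p e) (\<Prod>i\<in>UNIV. [:u $ i, staircase $ i:])"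
  proof (rule poly_eqI_infinite)
    show "infinite {2 * norm u..}"
      by (rule infinite_Ici)
    fix s
    assume "s \<in> {2 * norm u..}"
    then have "lam (\<Delta> (u + s *\<^sub>R staircase)) = u + s *\<^sub>R staircase"
      by (intro lam_diag eventually_decreasing) simp
    then show "poly f s = poly (smult (p e) (\<Prod>i\<in>UNIV. [:u $ i, staircase $ i:])) s"
      using eigenvalues_spec(2)[of "\<Delta> (u + s *\<^sub>R staircase)" 0]
      by (simp add: f poly_prod linear_add[OF linear_diag] linear_scale[OF linear_diag])
  qed
  then show ?thesis
    using f[of 0] by (simp add: poly_prod)
qed

text \<open>Subtracting e shifts all eigenvalues of \<Delta> 1 from 1 to 0, and completeness
  applies.\<close>

lemma diag_one: "\<Delta> 1 = e"
proof -
  have "1 \<in> decreasing_vectors"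
    by (simp add: decreasing_vectors_def)
  then have one: "lam (\<Delta> 1) = 1"
    by (rule lam_diag)
  have "lam (\<Delta> 1 - e) = 0"
  proof (rule eigenvalues_unique)
    fix t
    have "\<Delta> 1 - e - t *\<^sub>R e = \<Delta> 1 - (1 + t) *\<^sub>R e"
      by (simp add: algebra_simps)
    then show "p (\<Delta> 1 - e - t *\<^sub>R e) = p e * (\<Prod>i\<in>UNIV. (0 :: real^('d::{finite,linorder})) $ i - t)"
      by (simp only: eigenvalues_spec(2) one) simp
  qed (simp add: decreasing_vectors_def)
  then show ?thesis
    by (simp add: lam_0_iff)
qed

text \<open>\<open>axis i 1\<close> need not be decreasing, so \<open>lam_diag\<close> may not
  apply; instead \<open>p_diag\<close> evaluates \<open>p\<close> at e + r \<Delta>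
  (\<open>axis i 1\<close>), using \<Delta> 1 = e.\<close>

lemma rank_one_axis:
  assumes "A \<in> isometries"
  shows "rank_one (A (\<Delta> (axis i 1)))"
proof -
  have "poly (esym_poly (\<Delta> (axis i 1))) r = 1 + r" for r
  proof -
    have "e + r *\<^sub>R \<Delta> (axis i 1) = \<Delta> (1 + r *\<^sub>R axis i 1)"
      by (simp add: linear_add[OF linear_diag] linear_scale[OF linear_diag] diag_one)
    then have "p e * poly (esym_poly (\<Delta> (axis i 1))) r = p e * (\<Prod>j\<in>UNIV. (1 + r *\<^sub>R axis i 1) $ j)"
      unfolding p_shift[symmetric] by (simp only: p_diag)
    also have "(\<Prod>j\<in>UNIV. (1 + r *\<^sub>R axis i 1) $ j) = (\<Prod>j\<in>UNIV. if j = i then 1 + r else 1)"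
      by (rule prod.cong) (auto simp: axis_def)
    finally show ?thesis
      using p_e_nz by simp
  qed
  then have "esym_poly (\<Delta> (axis i 1)) = [:1, 1:]"
    by (simp add: fun_eq_iff flip: poly_eq_poly_eq_iff)
  then show ?thesis
    by (simp add: rank_one_def esym_poly_def lam_isometry[OF assms])
qed

lemma isometry_diag_expansion:
  assumes "A \<in> isometries"
  shows "A (\<Delta> u) = (\<Sum>i\<in>UNIV. u $ i *\<^sub>R A (\<Delta> (axis i 1)))"
proof -
  note lin = linear_compose[OF linear_diag isometry_linear[OF assms], unfolded comp_def]
  have "A (\<Delta> u) = A (\<Delta> (\<Sum>i\<in>UNIV. u $ i *\<^sub>R axis i 1))"
    using basis_expansion[of u] by (simp add: scalar_mult_eq_scaleR)
  also have "\<dots> = (\<Sum>i\<in>UNIV. u $ i *\<^sub>R A (\<Delta> (axis i 1)))"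
    by (simp only: linear_sum[OF lin] linear_scale[OF lin])
  finally show ?thesis .
qed

lemma ip_diag_nonneg:
  assumes "A \<in> isometries" "B \<in> isometries"
    and "\<And>i. 0 \<le> u $ i" "\<And>i. 0 \<le> v $ i"
  shows "0 \<le> ip (A (\<Delta> u)) (B (\<Delta> v))"
proof -
  have "0 \<le> ip (B (\<Delta> v)) (A (\<Delta> (axis i 1)))" for i
    unfolding isometry_diag_expansion[OF assms(2), of v] ip_sum
    using assms(4) rank_one_axis[OF assms(1)] rank_one_axis[OF assms(2)]
    by (intro sum_nonneg mult_nonneg_nonneg rank_one_ip_nonneg) auto
  then show ?thesis
    unfolding isometry_diag_expansion[OF assms(1), of u] ip_sum
    using assms(3) by (intro sum_nonneg mult_nonneg_nonneg) (auto simp: ip_commute)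
qed

section \<open>Projection onto the hyperbolicity cone\<close>

lemma hyperbolicity_cone_iff:
  "x \<in> hyperbolicity_cone TYPE('d) p e \<longleftrightarrow> (\<forall>i. 0 \<le> lam x $ i)"
proof -
  have "lam x $ Max UNIV \<le> lam x $ i" for i
    using eigenvalues_spec(1)[of x] by (simp add: decreasing_vectors_def)
  then show ?thesis
    unfolding hyperbolicity_cone_def using order_trans by blast
qed

lemma hyp_projection_diag:
  assumes A: "A \<in> isometries" and x: "x = A (\<Delta> (lam x))"
  shows "hyp_projection TYPE('d) p e x = A (\<Delta> (closest_point nonneg_orthant (lam x)))"
proof -
  let ?cone = "hyperbolicity_cone TYPE('d) p e"
  define u where "u = (\<chi> i. max 0 (lam x $ i))"
  \<comment> \<open>v increases along the indices; \<open>ip_diag_nonneg\<close> therefore has to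
    admit nonnegative vectors in any order.\<close>
  define v where "v = (\<chi> i. max 0 (- lam x $ i))"
  define y where "y = A (\<Delta> u)"
  define w where "w = A (\<Delta> v)"
  note lin = linear_compose[OF linear_diag isometry_linear[OF A], unfolded comp_def]
  have nsq_A: "nsq (A (\<Delta> a)) = (norm a)\<^sup>2" for a
    by (metis lam_isometry[OF A] nsq_diag nsq_lam)
  have "lam x = u - v"
    by (auto simp: u_def v_def vec_eq_iff max_def)
  then have xyw: "x = y - w"
    unfolding y_def w_def by (subst x) (simp only: linear_diff[OF lin])
  \<comment> \<open>u and v have disjoint supports; polarization transfers their orthogonality to y
    and w.\<close>
  have "norm (u + v) = norm (u - v)"
    unfolding norm_vec_def by (rule arg_cong[where f = "\<lambda>f. L2_set f UNIV"]) (auto simp: u_def v_def max_def)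
  then have orth: "ip y w = 0"
    using ip_nsq[of y w] unfolding y_def w_def
    by (simp add: nsq_A flip: linear_add[OF lin] linear_diff[OF lin])
  have "u \<in> decreasing_vectors"
    using eigenvalues_spec(1)[of x] by (auto simp: decreasing_vectors_def u_def max.coboundedI2)
  then have "lam y = u"
    unfolding y_def by (simp add: lam_isometry[OF A] lam_diag)
  then have y: "y \<in> ?cone"
    by (simp add: hyperbolicity_cone_iff u_def)
  \<comment> \<open>The extra term \<open>nsq (y - z)\<close> yields uniqueness of the minimizer
    along with minimality.\<close>
  have gap: "nsq (x - y) + nsq (y - z) \<le> nsq (x - z)" if z: "z \<in> ?cone" for z
  proof -
    obtain B where "B \<in> isometries" "z = B (\<Delta> (lam z))"
      using diagonalize .
    then have "0 \<le> ip z w"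
      using ip_diag_nonneg[of B A "lam z" v] A z unfolding w_def hyperbolicity_cone_iff
      by (simp add: v_def)
    moreover have "ip (y - z) w = - ip z w"
      using ip_add[of y "- z" w] ip_scale[of "- 1" z w] orth by simp
    moreover have "nsq (x - z) = nsq (y - z) + nsq w - 2 * ip (y - z) w"
      using nsq_diff[of "y - z" w] by (simp add: xyw algebra_simps)
    ultimately show ?thesis
      by (simp add: xyw)
  qed
  have mono: "hyp_norm TYPE('d) p e a \<le> hyp_norm TYPE('d) p e b \<longleftrightarrow> nsq a \<le> nsq b" for a b
    by (simp add: nsq_def hyp_norm_def abs_le_square_iff[symmetric])
  \<comment> \<open>\<open>arg_min_on\<close> chooses some minimizer; \<open>gap\<close> and
    completeness force any choice to be y.\<close>
  have "(SOME z. is_arg_min (\<lambda>z. hyp_norm TYPE('d) p e (x - z)) (\<lambda>z. z \<in> ?cone) z) = y"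
  proof (rule some_equality)
    show "is_arg_min (\<lambda>z. hyp_norm TYPE('d) p e (x - z)) (\<lambda>z. z \<in> ?cone) y"
      unfolding is_arg_min_linorder mono
    proof (intro conjI allI impI)
      fix z
      assume "z \<in> ?cone"
      then show "nsq (x - y) \<le> nsq (x - z)"
        using gap[of z] nsq_nonneg[of "y - z"] by linarith
    qed (rule y)
    fix z
    assume "is_arg_min (\<lambda>z. hyp_norm TYPE('d) p e (x - z)) (\<lambda>z. z \<in> ?cone) z"
    then have "z \<in> ?cone" "nsq (x - z) \<le> nsq (x - y)"
      using y unfolding is_arg_min_linorder mono by auto
    then have "nsq (y - z) \<le> 0"
      using gap by fastforce
    then have "y - z = 0"
      by (simp add: nsq_lam flip: lam_0_iff)
    then show "z = y" by simp
  qed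
  then show ?thesis
    unfolding hyp_projection_def arg_min_on_def arg_min_def closest_point_nonneg_orthant
    by (simp add: y_def u_def)
qed

end

theorem proposition3p9:
  fixes p :: "real^'n \<Rightarrow> real"
    and e x :: "real^'n"
    and \<Delta> :: "real^('d::{finite,linorder}) \<Rightarrow> real^'n"
    and A :: "real^'n \<Rightarrow> real^'n"
  assumes "hyperbolic CARD('d) p e"
    and "complete_hyperbolic TYPE('d) p e"
    and "diagonalizable_by p e \<Delta>"
    and "range (eigenvalues p e) = (decreasing_vectors :: (real^('d::{finite,linorder})) set)"
    and "A \<in> eigenvalue_isometries TYPE('d) p e"
    and "x = A (\<Delta> (eigenvalues p e x))"
  shows "hyp_projection TYPE('d) p e x =
           A (\<Delta> (closest_point nonneg_orthant (eigenvalues p e x)))"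
proof -
  have loc: "diagonalized_polynomial p e \<Delta>"
    by (intro diagonalized_polynomial.intro hyperbolic_polynomial.intro
        diagonalized_polynomial_axioms.intro assms)
  show ?thesis
    using diagonalized_polynomial.hyp_projection_diag[OF loc] assms(5,6)
    unfolding diagonalized_polynomial.isometries_def[OF loc] by blast
qed

end
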